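(* Let $a<b$ be real numbers, $\Omega=[a,b]$, $m\ge 1$ an integer, and let $\mathcal{X}=\{x_i=a+i\,\tfrac{b-a}{2m}:\ i=0,\ldots,2m\}$. Let $\mathcal{X}^{\mathrm{e}}=\{x_{2k}: k=0,\ldots,m\}$ and $\mathcal{X}^{\mathrm{o}}=\{x_{2k-1}: k=1,\ldots,m\}$ be the subsets of nodes with even and odd indices, and let $S:\Omega\to[-1,1]$, $S(x)=-\cos\left(\frac{x-a}{b-a}\pi\right)$. Then the composite Cavalieri-Simpson formula at $\mathcal{X}$ is a convex combination of the mapped interpolatory quadrature formula $Q^S_{\mathcal{X}^{\mathrm{o}}}$ on $\mathcal{X}^{\mathrm{o}}$ and the mapped interpolatory quadrature formula $Q^S_{\mathcal{X}^{\mathrm{e}}}$ on $\mathcal{X}^{\mathrm{e}}$; that is, there exists $\theta\in[0,1]$ such that for every continuous $f:\Omega\to\mathbb{R}$, $$\frac{b-a}{6m}\left(f(x_0)+2\sum_{i=1}^{m-1}f(x_{2i})+4\sum_{i=1}^{m}f(x_{2i-1})+f(x_{2m})\right)=\theta\,Q^S_{\mathcal{X}^{\mathrm{o}}}(f)+(1-\theta)\,Q^S_{\mathcal{X}^{\mathrm{e}}}(f).$$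
   Context: For a finite set $\mathcal{Y}=\{y_0,\ldots,y_r\}\subset\Omega=[a,b]$ of distinct nodes and an injective map $S:\Omega\to\mathbb{R}$, let $\ell_i^S(y)=\prod_{0\le j\le r,\ j\ne i}\frac{y-S(y_j)}{S(y_i)-S(y_j)}$ be the Lagrange polynomials on the mapped nodes $S(\mathcal{Y})$. The mapped interpolatory quadrature formula on $\mathcal{Y}$ is $Q^S_{\mathcal{Y}}(f)=\sum_{i=0}^r w_i^S f(y_i)$ with weights $w_i^S=\int_a^b\ell_i^S(S(x))\,\mathrm{d}x$. The composite Cavalieri-Simpson formula at $\mathcal{X}$ (for $m$ subintervals of $[a,b]$ with their midpoints) is the left-hand side of the displayed identity. *)

theory Defs
  imports "HOL-Analysis.Analysis"
begin

definition mapped_lagrange :: "(real \<Rightarrow> real) \<Rightarrow> real set \<Rightarrow> real \<Rightarrow> real \<Rightarrow> real" where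
  "mapped_lagrange S Y u t = (\<Prod>v\<in>Y - {u}. (t - S v) / (S u - S v))"

definition mapped_weight ::
    "real \<Rightarrow> real \<Rightarrow> (real \<Rightarrow> real) \<Rightarrow> real set \<Rightarrow> real \<Rightarrow> real" where
  "mapped_weight a b S Y u = integral {a..b} (\<lambda>x. mapped_lagrange S Y u (S x))"

text \<open>The node family is given as a finite set, so distinctness of the nodes is automatic;
  the definition is meaningful for finite \<open>Y \<subseteq> {a..b}\<close> and \<open>S\<close> injective on \<open>{a..b}\<close>.\<close>

definition mapped_quadrature ::
    "real \<Rightarrow> real \<Rightarrow> (real \<Rightarrow> real) \<Rightarrow> real set \<Rightarrow> (real \<Rightarrow> real) \<Rightarrow> real" where
  "mapped_quadrature a b S Y f = (\<Sum>u\<in>Y. mapped_weight a b S Y u * f u)"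

definition equi_node :: "real \<Rightarrow> real \<Rightarrow> nat \<Rightarrow> nat \<Rightarrow> real" where
  "equi_node a b m i = a + real i * ((b - a) / (2 * real m))"

definition even_nodes :: "real \<Rightarrow> real \<Rightarrow> nat \<Rightarrow> real set" where
  "even_nodes a b m = {equi_node a b m (2 * k) | k. k \<in> {0..m}}"

definition odd_nodes :: "real \<Rightarrow> real \<Rightarrow> nat \<Rightarrow> real set" where
  "odd_nodes a b m = {equi_node a b m (2 * k - 1) | k. k \<in> {1..m}}"

definition cos_map :: "real \<Rightarrow> real \<Rightarrow> real \<Rightarrow> real" where
  "cos_map a b x = - cos ((x - a) / (b - a) * pi)"

definition composite_simpson :: "real \<Rightarrow> real \<Rightarrow> nat \<Rightarrow> (real \<Rightarrow> real) \<Rightarrow> real" where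
  "composite_simpson a b m f =
     (b - a) / (6 * real m) *
       (f (equi_node a b m 0)
        + 2 * (\<Sum>i = 1..m - 1. f (equi_node a b m (2 * i)))
        + 4 * (\<Sum>i = 1..m. f (equi_node a b m (2 * i - 1)))
        + f (equi_node a b m (2 * m)))"

end

theory Submission
  imports Defs
begin

text \<open>
  The convex combination is the classical one, with \<open>\<theta> = 2/3\<close>: Simpson's rule is two thirds of the
  composite midpoint rule plus one third of the composite trapezoidal rule. What has to be shown is
  that the two mapped interpolatory formulas are these two rules.

  Put \<open>t = (x - a) / (b - a) * pi\<close>. The mapped Lagrange functions are products of affine functions of
  \<open>cos t\<close>, hence cosine polynomials in \<open>t\<close> of degree at most the number of nodes minus one, which is
  smaller than \<open>2m\<close> in both cases (\<open>cosine_poly_mapped_lagrange\<close>). On equispaced nodes the midpoint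
  and trapezoidal rules integrate cosine polynomials of degree below \<open>2m\<close> exactly
  (\<open>midpoint_exact\<close>, \<open>trapezoid_exact\<close>), because both the integral of \<open>cos (k * t)\<close> and its
  weighted sum over the nodes vanish for \<open>0 < k < 2m\<close>. A rule that is exact on the Lagrange functions has the
  interpolatory weights (\<open>mapped_quadrature_eqI\<close>).
\<close>

section \<open>Cosine polynomials\<close>

inductive cosine_poly :: "nat \<Rightarrow> (real \<Rightarrow> real) \<Rightarrow> bool" for d :: nat where
  cos: "k \<le> d \<Longrightarrow> cosine_poly d (\<lambda>t. c * cos (real k * t))"
| add: "cosine_poly d f \<Longrightarrow> cosine_poly d g \<Longrightarrow> cosine_poly d (\<lambda>t. f t + g t)"

text \<open>The degree grows by one because \<open>2 cos (k t) cos t = cos ((k + 1) t) + cos ((k - 1) t)\<close>.\<close>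

lemma cosine_poly_mult_affine_cos:
  assumes "cosine_poly d f"
  shows "cosine_poly (Suc d) (\<lambda>t. (A + B * cos t) * f t)"
  using assms
proof (induction rule: cosine_poly.induct)
  case (cos k c)
  show ?case
  proof (cases k)
    case 0
    have "cosine_poly (Suc d) (\<lambda>t. A * c * cos (real 0 * t) + B * c * cos (real 1 * t))"
      by (intro cosine_poly.intros) auto
    then show ?thesis by (simp add: 0 algebra_simps)
  next
    case (Suc n)
    have eq: "(A + B * cos t) * (c * cos (real k * t)) =
        A * c * cos (real k * t) +
        (B * c / 2 * cos (real (Suc k) * t) + B * c / 2 * cos (real n * t))" for t
    proof -
      have "real (Suc k) * t = real k * t + t" "real n * t = real k * t - t"
        by (simp_all add: Suc algebra_simps)
      then show ?thesis
        by (simp only: cos_add cos_diff) (simp add: algebra_simps)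
    qed
    show ?thesis
      unfolding eq by (intro cosine_poly.intros) (use cos Suc in auto)
  qed
next
  case (add f g)
  then show ?case
    by (simp add: distrib_left cosine_poly.add)
qed

lemma cosine_poly_prod_affine_cos:
  assumes "finite V"
  shows "cosine_poly (card V) (\<lambda>t. \<Prod>v\<in>V. A v + B v * cos t)"
  using assms
proof (induction rule: finite_induct)
  case empty
  show ?case using cosine_poly.cos[of 0 0 1] by simp
next
  case (insert v V)
  then show ?case
    using cosine_poly_mult_affine_cos[OF insert.IH, of "A v" "B v"] by simp
qed

section \<open>Mapped interpolatory formulas with equispaced nodes\<close>

definition angle :: "real \<Rightarrow> real \<Rightarrow> real \<Rightarrow> real" where
  "angle a b x = (x - a) / (b - a) * pi"

lemma inj_on_cos_map:
  assumes "a < b"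
  shows "inj_on (cos_map a b) {a..b}"
proof (rule inj_onI)
  fix x y assume xy: "x \<in> {a..b}" "y \<in> {a..b}" "cos_map a b x = cos_map a b y"
  have range: "angle a b z \<in> {0..pi}" if "z \<in> {a..b}" for z
    using that assms mult_right_mono[of "(z - a) / (b - a)" 1 pi] by (auto simp: angle_def)
  have "angle a b x = angle a b y"
    by (rule cos_inj_pi) (use xy range in \<open>auto simp: cos_map_def angle_def\<close>)
  then show "x = y" using assms by (simp add: angle_def)
qed

lemma cosine_poly_mapped_lagrange:
  assumes "finite Y" and "u \<in> Y"
  obtains g where "cosine_poly (card Y - 1) g"
    and "\<And>x. mapped_lagrange (cos_map a b) Y u (cos_map a b x) = g (angle a b x)"
proof
  let ?S = "cos_map a b"
  let ?g = "\<lambda>t. \<Prod>v\<in>Y - {u}. - ?S v / (?S u - ?S v) + (- 1 / (?S u - ?S v)) * cos t"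
  show "cosine_poly (card Y - 1) ?g"
    using cosine_poly_prod_affine_cos[of "Y - {u}" "\<lambda>v. - ?S v / (?S u - ?S v)"
        "\<lambda>v. - 1 / (?S u - ?S v)"] assms by simp
  show "mapped_lagrange ?S Y u (?S x) = ?g (angle a b x)" for x
    unfolding mapped_lagrange_def
    by (rule prod.cong) (auto simp: cos_map_def[of a b x] angle_def diff_divide_distrib)
qed

lemma mapped_lagrange_at_node:
  assumes "finite Y" "inj_on S Y" "u \<in> Y" "v \<in> Y"
  shows "mapped_lagrange S Y u (S v) = (if v = u then 1 else 0)"
proof (cases "v = u")
  case True
  have "S u - S w \<noteq> 0" if "w \<in> Y - {u}" for w
    using that assms by (auto dest: inj_onD)
  then show ?thesis by (simp add: True mapped_lagrange_def)
next
  case False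
  then show ?thesis using assms by (auto simp: mapped_lagrange_def intro!: prod_zero)
qed

text \<open>Uniqueness of interpolatory weights: exactness applied to the Lagrange function of a node
  identifies the weight of that node.\<close>

lemma mapped_quadrature_eqI:
  assumes "a < b" "finite I" "inj_on y I" "y ` I \<subseteq> {a..b}"
    and exact: "\<And>g. cosine_poly (card I - 1) g \<Longrightarrow>
      ((\<lambda>x. g (angle a b x)) has_integral (\<Sum>i\<in>I. w i * g (angle a b (y i)))) {a..b}"
  shows "mapped_quadrature a b (cos_map a b) (y ` I) f = (\<Sum>i\<in>I. w i * f (y i))"
proof -
  let ?S = "cos_map a b" and ?Y = "y ` I"
  have inj: "inj_on ?S ?Y"
    using inj_on_cos_map[OF \<open>a < b\<close>] assms(4) by (rule inj_on_subset)
  have weight: "mapped_weight a b ?S ?Y (y i) = w i" if "i \<in> I" for i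
  proof -
    obtain g where g: "cosine_poly (card ?Y - 1) g"
      and gL: "\<And>x. mapped_lagrange ?S ?Y (y i) (?S x) = g (angle a b x)"
      using cosine_poly_mapped_lagrange[OF finite_imageI[OF assms(2)] imageI[OF \<open>i \<in> I\<close>], of y a b]
      by metis
    have delta: "g (angle a b (y j)) = (if j = i then 1 else 0)" if "j \<in> I" for j
      using mapped_lagrange_at_node[OF _ inj, of "y i" "y j"] that \<open>i \<in> I\<close> assms(2,3)
      by (auto simp: gL[symmetric] inj_on_eq_iff)
    have "mapped_weight a b ?S ?Y (y i) = (\<Sum>j\<in>I. w j * g (angle a b (y j)))"
      unfolding mapped_weight_def gL
      by (rule integral_unique, rule exact) (use g card_image[OF assms(3)] in simp)
    also have "\<dots> = (\<Sum>j\<in>I. if j = i then w j else 0)"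
      by (rule sum.cong) (auto simp: delta)
    also have "\<dots> = w i" using that assms(2) by simp
    finally show ?thesis .
  qed
  show ?thesis
    unfolding mapped_quadrature_def by (simp add: sum.reindex[OF assms(3)] weight)
qed

section \<open>Exactness of the midpoint and trapezoidal rules\<close>

lemma has_integral_cos_angle:
  assumes "a < b"
  shows "((\<lambda>x. cos (real k * angle a b x)) has_integral (if k = 0 then b - a else 0)) {a..b}"
proof (cases "k = 0")
  case True
  then show ?thesis using has_integral_const_real[of "1 :: real" a b] assms by simp
next
  case False
  let ?F = "\<lambda>x. (b - a) / (real k * pi) * sin (real k * angle a b x)"
  have "((\<lambda>x. cos (real k * angle a b x)) has_integral (?F b - ?F a)) {a..b}"
  proof (rule fundamental_theorem_of_calculus)
    show "a \<le> b" using assms by simp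
    fix x
    have "(angle a b has_real_derivative pi / (b - a)) (at x within {a..b})"
      unfolding angle_def using assms by (auto intro!: derivative_eq_intros)
    then show "(?F has_vector_derivative cos (real k * angle a b x)) (at x within {a..b})"
      unfolding has_real_derivative_iff_has_vector_derivative[symmetric]
      using assms False by (auto intro!: derivative_eq_intros)
  qed
  moreover have "?F b = 0" "?F a = 0"
    using assms by (simp_all add: angle_def)
  ultimately show ?thesis using False by (simp only: diff_self if_False)
qed

lemma angle_equi_node:
  assumes "a < b"
  shows "angle a b (equi_node a b m i) = real i * (pi / (2 * real m))"
  using assms by (simp add: angle_def equi_node_def)

text \<open>With \<open>h = k * pi / (2m)\<close>, multiplying by \<open>2 sin h\<close> makes the sum telescope to
  \<open>sin (k * pi) = 0\<close>; the factor is nonzero because \<open>0 < k < 2m\<close> puts \<open>h\<close> inside \<open>(0, pi)\<close>.\<close>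

lemma sum_cos_midpoints:
  assumes "0 < k" "k < 2 * m"
  shows "(\<Sum>i = 1..m. cos (real k * (real (2 * i - 1) * (pi / (2 * real m))))) = 0"
proof -
  define h where "h = real k * (pi / (2 * real m))"
  have "0 < h" "h < pi" using assms by (auto simp: h_def field_simps)
  then have "sin h \<noteq> 0" using sin_gt_zero by fastforce
  have telescope: "2 * sin h * (\<Sum>i = 1..n. cos (real (2 * i - 1) * h)) = sin (real (2 * n) * h)" for n
  proof (induction n)
    case (Suc n)
    have "real (2 * Suc n) * h = real (2 * Suc n - 1) * h + h"
      "real (2 * n) * h = real (2 * Suc n - 1) * h - h"
      by (simp_all add: algebra_simps)
    then have "sin (real (2 * Suc n) * h) =
        sin (real (2 * n) * h) + 2 * sin h * cos (real (2 * Suc n - 1) * h)"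
      by (simp only: sin_add sin_diff) simp
    then show ?case using Suc by (simp add: distrib_left)
  qed simp
  have "real (2 * m) * h = real k * pi" using assms by (simp add: h_def)
  then have "2 * sin h * (\<Sum>i = 1..m. cos (real (2 * i - 1) * h)) = 0"
    using telescope[of m] by simp
  then show ?thesis using \<open>sin h \<noteq> 0\<close> by (simp add: h_def mult.left_commute)
qed

text \<open>The trapezoidal rule averages over adjacent nodes, and the average of \<open>cos (k t)\<close> over two adjacent
  nodes at distance \<open>2h\<close> is \<open>cos (k h)\<close> times its value at the midpoint, so this case reduces to that of midpoints.\<close>

lemma sum_cos_trapezoid:
  assumes "0 < k" "k < 2 * m"
  shows "(\<Sum>i = 1..m. (cos (real k * (real (2 * (i - 1)) * (pi / (2 * real m)))) +
      cos (real k * (real (2 * i) * (pi / (2 * real m))))) / 2) = 0"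
proof -
  define h where "h = pi / (2 * real m)"
  have "(cos (real k * (real (2 * (i - 1)) * h)) + cos (real k * (real (2 * i) * h))) / 2 =
      cos (real k * h) * cos (real k * (real (2 * i - 1) * h))" if "i \<in> {1..m}" for i
  proof -
    have "real k * (real (2 * (i - 1)) * h) = real k * (real (2 * i - 1) * h) - real k * h"
      "real k * (real (2 * i) * h) = real k * (real (2 * i - 1) * h) + real k * h"
      using that by (simp_all add: of_nat_diff algebra_simps)
    then show ?thesis by (simp only: cos_add cos_diff) simp
  qed
  then have "(\<Sum>i = 1..m. (cos (real k * (real (2 * (i - 1)) * h)) +
        cos (real k * (real (2 * i) * h))) / 2) =
      (\<Sum>i = 1..m. cos (real k * h) * cos (real k * (real (2 * i - 1) * h)))"
    by (rule sum.cong[OF refl])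
  then show ?thesis
    using sum_cos_midpoints[OF assms] by (simp add: h_def flip: sum_distrib_left)
qed

lemma midpoint_exact:
  assumes "a < b" "cosine_poly d g" "d < 2 * m"
  shows "((\<lambda>x. g (angle a b x)) has_integral
      (\<Sum>i = 1..m. (b - a) / real m * g (angle a b (equi_node a b m (2 * i - 1))))) {a..b}"
  using assms(2)
proof (induction rule: cosine_poly.induct)
  case (cos k c)
  let ?C = "\<lambda>i. cos (real k * (real (2 * i - 1) * (pi / (2 * real m))))"
  have "(\<Sum>i = 1..m. (b - a) / real m * (c * cos (real k * angle a b (equi_node a b m (2 * i - 1)))))
      = (b - a) / real m * c * (\<Sum>i = 1..m. ?C i)"
    unfolding sum_distrib_left angle_equi_node[OF assms(1)] by (simp only: mult.assoc)
  also have "\<dots> = c * (if k = 0 then b - a else 0)"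
  proof (cases "k = 0")
    case True
    then show ?thesis using assms(3) by simp
  next
    case False
    have "(\<Sum>i = 1..m. ?C i) = 0"
      by (rule sum_cos_midpoints) (use False cos assms(3) in auto)
    then show ?thesis using False by simp
  qed
  finally show ?case
    using has_integral_mult_right[OF has_integral_cos_angle[OF assms(1)], of c k] by simp
next
  case (add f g)
  show ?case
    using has_integral_add[OF add.IH] by (simp only: distrib_left sum.distrib)
qed

text \<open>The trapezoidal rule in the two forms needed: by nodes, as in its weights, and by subintervals.\<close>

lemma trapezoid_sum:
  fixes F :: "nat \<Rightarrow> real"
  assumes "m \<ge> 1"
  shows "(\<Sum>i = 0..m. (if i = 0 \<or> i = m then 1 / 2 else 1) * F i) =
      F 0 / 2 + (\<Sum>i = 1..m - 1. F i) + F m / 2" (is ?nodes)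
    and "(\<Sum>i = 1..m. (F (i - 1) + F i) / 2) = F 0 / 2 + (\<Sum>i = 1..m - 1. F i) + F m / 2"
      (is ?intervals)
proof -
  obtain n where m: "m = Suc n" using assms by (cases m) auto
  have split: "(\<Sum>i = 0..m. G i) = G 0 + (\<Sum>i = 1..n. G i) + G m" for G :: "nat \<Rightarrow> real"
    unfolding m by (induction n) simp_all
  have "(\<Sum>i = 1..n. (if i = 0 \<or> i = m then 1 / 2 else 1) * F i) = (\<Sum>i = 1..n. F i)"
    by (rule sum.cong) (auto simp: m)
  then show ?nodes
    unfolding split by (simp add: m)
  show ?intervals
    unfolding m by (induction n) (simp_all add: add_divide_distrib)
qed

lemma trapezoid_exact:
  assumes "a < b" "cosine_poly d g" "d < 2 * m"
  shows "((\<lambda>x. g (angle a b x)) has_integral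
      (\<Sum>i = 0..m. (b - a) / real m * (if i = 0 \<or> i = m then 1 / 2 else 1) *
        g (angle a b (equi_node a b m (2 * i))))) {a..b}"
  using assms(2)
proof (induction rule: cosine_poly.induct)
  case (cos k c)
  let ?C = "\<lambda>i. cos (real k * (real (2 * i) * (pi / (2 * real m))))"
  have m: "m \<ge> 1" using assms(3) by simp
  have "(\<Sum>i = 0..m. (b - a) / real m * (if i = 0 \<or> i = m then 1 / 2 else 1) *
        (c * cos (real k * angle a b (equi_node a b m (2 * i))))) =
      (b - a) / real m * c * (\<Sum>i = 0..m. (if i = 0 \<or> i = m then 1 / 2 else 1) * ?C i)"
    unfolding sum_distrib_left angle_equi_node[OF assms(1)] by (simp add: mult_ac)
  also have "(\<Sum>i = 0..m. (if i = 0 \<or> i = m then 1 / 2 else 1) * ?C i) =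
      (\<Sum>i = 1..m. (?C (i - 1) + ?C i) / 2)"
    by (simp only: trapezoid_sum(1)[OF m, of ?C] trapezoid_sum(2)[OF m, of ?C])
  also have "(b - a) / real m * c * \<dots> = c * (if k = 0 then b - a else 0)"
  proof (cases "k = 0")
    case True
    then show ?thesis using m by simp
  next
    case False
    have "(\<Sum>i = 1..m. (?C (i - 1) + ?C i) / 2) = 0"
      by (rule sum_cos_trapezoid) (use False cos assms(3) in auto)
    then show ?thesis using False by simp
  qed
  finally show ?case
    using has_integral_mult_right[OF has_integral_cos_angle[OF assms(1)], of c k] by simp
next
  case (add f g)
  show ?case
    using has_integral_add[OF add.IH] by (simp only: distrib_left sum.distrib)
qed

section \<open>Simpson's rule as a convex combination\<close>

lemma equi_node_in_interval:
  assumes "a < b" "i \<le> 2 * m"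
  shows "equi_node a b m i \<in> {a..b}"
proof -
  have "real i * (b - a) \<le> real (2 * m) * (b - a)"
    by (rule mult_right_mono) (use assms in \<open>auto simp flip: of_nat_mult\<close>)
  then have "real i * ((b - a) / (2 * real m)) \<le> b - a"
    using assms by (cases "m = 0") (auto simp: field_simps)
  then show ?thesis using assms by (simp add: equi_node_def)
qed

lemma equi_node_eq_iff:
  assumes "a < b" "m \<ge> 1"
  shows "equi_node a b m i = equi_node a b m j \<longleftrightarrow> i = j"
  using assms by (simp add: equi_node_def)

lemma mapped_quadrature_odd_nodes:
  assumes "a < b" "m \<ge> 1"
  shows "mapped_quadrature a b (cos_map a b) (odd_nodes a b m) f =
      (\<Sum>i = 1..m. (b - a) / real m * f (equi_node a b m (2 * i - 1)))"
proof -
  have "odd_nodes a b m = (\<lambda>i. equi_node a b m (2 * i - 1)) ` {1..m}"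
    by (auto simp: odd_nodes_def)
  moreover have "inj_on (\<lambda>i. equi_node a b m (2 * i - 1)) {1..m}"
    by (auto simp: inj_on_def equi_node_eq_iff[OF assms])
  moreover have "(\<lambda>i. equi_node a b m (2 * i - 1)) ` {1..m} \<subseteq> {a..b}"
    using equi_node_in_interval[OF assms(1), of _ m] by force
  ultimately show ?thesis
    using mapped_quadrature_eqI[OF assms(1), of "{1..m}" "\<lambda>i. equi_node a b m (2 * i - 1)"
        "\<lambda>_. (b - a) / real m" f] midpoint_exact[OF assms(1), of "m - 1" _ m] assms(2)
    by simp
qed

lemma mapped_quadrature_even_nodes:
  assumes "a < b" "m \<ge> 1"
  shows "mapped_quadrature a b (cos_map a b) (even_nodes a b m) f =
      (\<Sum>i = 0..m. (b - a) / real m * (if i = 0 \<or> i = m then 1 / 2 else 1) *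
        f (equi_node a b m (2 * i)))"
proof -
  have nodes: "even_nodes a b m = (\<lambda>i. equi_node a b m (2 * i)) ` {0..m}"
    by (auto simp: even_nodes_def)
  show ?thesis
    unfolding nodes
  proof (rule mapped_quadrature_eqI)
    show "inj_on (\<lambda>i. equi_node a b m (2 * i)) {0..m}"
      by (auto simp: inj_on_def equi_node_eq_iff[OF assms])
    show "(\<lambda>i. equi_node a b m (2 * i)) ` {0..m} \<subseteq> {a..b}"
      using equi_node_in_interval[OF assms(1), of _ m] by force
  next
    fix g assume "cosine_poly (card {0..m} - 1) g"
    then show "((\<lambda>x. g (angle a b x)) has_integral
        (\<Sum>i = 0..m. (b - a) / real m * (if i = 0 \<or> i = m then 1 / 2 else 1) *
          g (angle a b (equi_node a b m (2 * i))))) {a..b}"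
      by (rule trapezoid_exact[OF assms(1)]) (use assms(2) in simp)
  qed (use assms in auto)
qed

theorem mainTheorem2:
  fixes a b :: real and m :: nat
  assumes "a < b" and "m \<ge> 1"
  shows "\<exists>\<theta>\<in>{0..1::real}. \<forall>f :: real \<Rightarrow> real. continuous_on {a..b} f \<longrightarrow>
           composite_simpson a b m f =
             \<theta> * mapped_quadrature a b (cos_map a b) (odd_nodes a b m) f
             + (1 - \<theta>) * mapped_quadrature a b (cos_map a b) (even_nodes a b m) f"
proof (intro bexI[of _ "2/3"] allI impI)
  fix f :: "real \<Rightarrow> real"
  define E O' where "E = (\<Sum>i = 1..m - 1. f (equi_node a b m (2 * i)))"
    and "O' = (\<Sum>i = 1..m. f (equi_node a b m (2 * i - 1)))"
  have odd: "mapped_quadrature a b (cos_map a b) (odd_nodes a b m) f = (b - a) / real m * O'"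
    unfolding mapped_quadrature_odd_nodes[OF assms] O'_def by (simp only: sum_distrib_left)
  have even: "mapped_quadrature a b (cos_map a b) (even_nodes a b m) f =
      (b - a) / real m * (f (equi_node a b m 0) / 2 + E + f (equi_node a b m (2 * m)) / 2)"
    unfolding mapped_quadrature_even_nodes[OF assms] E_def
    using trapezoid_sum(1)[OF assms(2), of "\<lambda>i. f (equi_node a b m (2 * i))"]
    by (simp only: mult.assoc flip: sum_distrib_left) simp
  show "composite_simpson a b m f =
      2/3 * mapped_quadrature a b (cos_map a b) (odd_nodes a b m) f
      + (1 - 2/3) * mapped_quadrature a b (cos_map a b) (even_nodes a b m) f"
    unfolding odd even composite_simpson_def E_def[symmetric] O'_def[symmetric]
    using assms by (simp add: field_simps)
qed simp

end
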